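(* Let $T$ be a rooted tree with descent set $V_D$ such that either the root of $T$ is in $V_D$ or all the children of the root are in $V_D$, and let $h=\deg d(T;n)$. If $z\in\mathbb{C}$ is such that $d(T;z)=0$, then $|z|\le h$.
   Context: Rooted trees are finite and nonempty. $T$ has vertex set $V$ of size $s$; $p(v)$ is the parent of a non-root vertex $v$. $T$ comes with a distinguished subset $V_D\subseteq V$, whose elements are called descent vertices; all other vertices are ascent vertices. For an integer $n\ge s$, $G(T;n)$ is the rooted tree with $n$ vertices obtained by adding a chain of $n-s$ vertices above the root of $T$ (if $n>s$, the root of $T$ becomes the child of the bottom vertex of the chain and the top of the chain is the root of $G(T;n)$); the added vertices are ascent vertices. A labeling of a rooted tree with $m$ vertices is a bijection $w$ from its vertices to $[m]=\{1,\dots,m\}$, and $\mathrm{Des}(w)$ is the set of non-root vertices $v$ with $w(v)>w(p(v))$. $D(T;n)$ is the set of labelings $w$ of $G(T;n)$ with $\mathrm{Des}(w)=V_D$, and $d(T;n)=|D(T;n)|$. The function $d(T;n)$ of integers $n\ge s$ agrees with a unique polynomial in $n$, also denoted $d(T;n)$; its degree $h$ is the sum, over the descent vertices $v$ having no proper ancestor in $V_D$, of the number of vertices in the subtree rooted at $v$. For $z\in\mathbb{C}$, $d(T;z)$ is the value of this polynomial at $z$. *)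

theory Defs
  imports Complex_Main "HOL-Library.FuncSet" "HOL-Computational_Algebra.Polynomial"
begin

text \<open>
  The value of the parent function \<open>p\<close> is irrelevant at the root \<open>r\<close> and outside \<open>V\<close>.
  The iterate \<open>k\<close> in \<open>reach\<close> can be taken minimal, so that \<open>p\<close> is only iterated at
  non-root vertices.
\<close>

locale rooted_tree =
  fixes V :: "'a set" and r :: 'a and p :: "'a \<Rightarrow> 'a"
  assumes finite_verts: "finite V"
    and root_in: "r \<in> V"
    and parent_in: "\<And>v. v \<in> V \<Longrightarrow> v \<noteq> r \<Longrightarrow> p v \<in> V"
    and reach: "\<And>v. v \<in> V \<Longrightarrow> \<exists>k. (p ^^ k) v = r"

definition children :: "'a set \<Rightarrow> 'a \<Rightarrow> ('a \<Rightarrow> 'a) \<Rightarrow> 'a \<Rightarrow> 'a set" where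
  "children V r p u = {v \<in> V - {r}. p v = u}"

text \<open>
  Functions are extensional (undefined outside \<open>V\<close>), so that distinct labelings are
  distinct functions and the number of labelings is finite.
\<close>

definition labelings :: "'a set \<Rightarrow> ('a \<Rightarrow> nat) set" where
  "labelings V = {w \<in> extensional V. bij_betw w V {1..card V}}"

definition Des :: "'a set \<Rightarrow> 'a \<Rightarrow> ('a \<Rightarrow> 'a) \<Rightarrow> ('a \<Rightarrow> nat) \<Rightarrow> 'a set" where
  "Des V r p w = {v \<in> V - {r}. w v > w (p v)}"

text \<open>
  The tree \<open>G(T;n)\<close>: the vertices \<open>Inr 0, \<dots>, Inr (n - s - 1)\<close>, where \<open>s = card V\<close>, form
  the added chain, numbered from bottom to top. These definitions are meant for \<open>n \<ge> s\<close>.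
  The parent of the topmost vertex is again an irrelevant value.
\<close>

definition G_verts :: "'a set \<Rightarrow> nat \<Rightarrow> ('a + nat) set" where
  "G_verts V n = Inl ` V \<union> Inr ` {..<n - card V}"

definition G_root :: "'a set \<Rightarrow> 'a \<Rightarrow> nat \<Rightarrow> 'a + nat" where
  "G_root V r n = (if n > card V then Inr (n - card V - 1) else Inl r)"

definition G_parent :: "'a \<Rightarrow> ('a \<Rightarrow> 'a) \<Rightarrow> 'a + nat \<Rightarrow> 'a + nat" where
  "G_parent r p x =
     (case x of Inl v \<Rightarrow> if v = r then Inr 0 else Inl (p v) | Inr i \<Rightarrow> Inr (Suc i))"

definition tree_D :: "'a set \<Rightarrow> 'a \<Rightarrow> ('a \<Rightarrow> 'a) \<Rightarrow> 'a set \<Rightarrow> nat \<Rightarrow> ('a + nat \<Rightarrow> nat) set" where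
  "tree_D V r p VD n =
     {w \<in> labelings (G_verts V n). Des (G_verts V n) (G_root V r n) (G_parent r p) w = Inl ` VD}"

definition tree_d :: "'a set \<Rightarrow> 'a \<Rightarrow> ('a \<Rightarrow> 'a) \<Rightarrow> 'a set \<Rightarrow> nat \<Rightarrow> nat" where
  "tree_d V r p VD n = card (tree_D V r p VD n)"

definition tree_d_poly :: "'a set \<Rightarrow> 'a \<Rightarrow> ('a \<Rightarrow> 'a) \<Rightarrow> 'a set \<Rightarrow> complex poly" where
  "tree_d_poly V r p VD = (THE q. \<forall>n\<ge>card V. poly q (of_nat n) = of_nat (tree_d V r p VD n))"

lemma (in rooted_tree) card_G_verts:
  assumes "n \<ge> card V"
  shows "card (G_verts V n) = n"
proof -
  have "card (G_verts V n) = card (Inl ` V :: ('a + nat) set) + card (Inr ` {..<n - card V} :: ('a + nat) set)"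
    unfolding G_verts_def by (rule card_Un_disjoint) (use finite_verts in auto)
  then show ?thesis
    using assms by (simp add: card_image)
qed

lemma (in rooted_tree) rooted_tree_G:
  "rooted_tree (G_verts V n) (G_root V r n) (G_parent r p)"
proof
  show "finite (G_verts V n)"
    using finite_verts by (simp add: G_verts_def)
  show "G_root V r n \<in> G_verts V n"
    using root_in by (auto simp: G_verts_def G_root_def)
  show "G_parent r p x \<in> G_verts V n" if "x \<in> G_verts V n" "x \<noteq> G_root V r n" for x
    using that parent_in
    by (auto simp: G_verts_def G_root_def G_parent_def split: if_splits)
  show "\<exists>k. (G_parent r p ^^ k) x = G_root V r n" if x: "x \<in> G_verts V n" for x
  proof -
    have chain: "(G_parent r p ^^ j) (Inr i) = Inr (i + j)" for i j
      by (induction j) (simp_all add: G_parent_def)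
    have inner: "\<exists>k. (G_parent r p ^^ k) (Inl v) = Inl r" if "(p ^^ j) v = r" for j v
      using that
    proof (induction j arbitrary: v)
      case 0
      then show ?case by (intro exI[of _ 0]) simp
    next
      case (Suc j)
      show ?case
      proof (cases "v = r")
        case True
        then show ?thesis by (intro exI[of _ 0]) simp
      next
        case False
        from Suc.prems have "(p ^^ j) (p v) = r" by (simp add: funpow_swap1)
        then obtain k where "(G_parent r p ^^ k) (Inl (p v)) = Inl r"
          using Suc.IH by blast
        then have "(G_parent r p ^^ Suc k) (Inl v) = Inl r"
          using False by (simp add: funpow_swap1 G_parent_def)
        then show ?thesis by blast
      qed
    qed
    have from_root: "\<exists>k. (G_parent r p ^^ k) (Inl r) = G_root V r n"
    proof (cases "n > card V")
      case True
      have "(G_parent r p ^^ Suc (n - card V - 1)) (Inl r) = Inr (n - card V - 1)"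
        using chain[of "n - card V - 1" 0]
        by (simp only: funpow_Suc_right o_apply) (simp add: G_parent_def)
      then show ?thesis using True unfolding G_root_def by (metis (full_types))
    next
      case False
      then show ?thesis by (intro exI[of _ 0]) (simp add: G_root_def)
    qed
    show ?thesis
    proof (cases x)
      case (Inl v)
      then have "v \<in> V" using x by (auto simp: G_verts_def)
      then obtain j where "(p ^^ j) v = r" using reach by blast
      then obtain k where k: "(G_parent r p ^^ k) (Inl v) = Inl r" using inner by blast
      obtain l where l: "(G_parent r p ^^ l) (Inl r) = G_root V r n" using from_root by blast
      have "(G_parent r p ^^ (l + k)) x = G_root V r n"
        using k l Inl by (simp add: funpow_add)
      then show ?thesis by blast
    next
      case (Inr i)
      then have "i < n - card V" using x by (auto simp: G_verts_def)
      then have "(G_parent r p ^^ (n - card V - 1 - i)) x = G_root V r n"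
        using Inr by (simp add: chain G_root_def)
      then show ?thesis by blast
    qed
  qed
qed

end

theory Submission
  imports Defs "HOL-Library.Infinite_Set"
begin

text \<open>
  The tree \<open>G(T;n)\<close> is a chain with increasing labels and a forest \<open>F\<close> attached to its bottom
  vertex, where the roots of \<open>F\<close> are exactly the attached vertices and all of them are descents: if
  the root of \<open>T\<close> is a descent vertex, then \<open>F = T\<close>; otherwise the root of \<open>T\<close> belongs to the chain
  and \<open>F\<close> is the forest below it. The hypothesis on \<open>T\<close> is what makes this splitting possible.
  Let \<open>h\<close> be the number of vertices of \<open>F\<close>.

  A labeling in \<open>D(T;n)\<close> amounts to the set \<open>U\<close> of the \<open>h\<close> labels used on \<open>F\<close> together with
  the standardized labeling \<open>w\<close> of \<open>F\<close>, because the chain is labeled by the complement of \<open>U\<close> in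
  increasing order. The standardized labeling must have the prescribed descents inside \<open>F\<close>, and
  the bottom of the chain must be below all roots of \<open>F\<close>. If \<open>j w\<close> is the least label of a
  root of \<open>F\<close> under \<open>w\<close>, the latter means \<open>\<not> {1..j w} \<subseteq> U\<close>
  (\<open>gap_below_iff_initial_segment_not_covered\<close>). Hence, by \<open>card_labelings_over_chain\<close>,
  \<open>d(T;n) = \<Sum>w. binom(n, h) - binom(n - j w, h - j w)\<close>, the sum ranging over the admissible
  labelings \<open>w\<close> of \<open>F\<close>.

  This is a polynomial of degree \<open>h\<close>: every summand has leading coefficient \<open>1 / h!\<close>, and
  there is at least one admissible \<open>w\<close> (\<open>forest_labelings_nonempty\<close>). At a complex number \<open>z\<close>
  with \<open>|z| > h\<close>, the ratio of the second binomial polynomial to the first is the product of the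
  quotients \<open>(h - i) / (z - i)\<close> over \<open>i < j w\<close>, and each of these has modulus less than one
  (\<open>norm_falling_tail_less\<close>). The first terms, which do not depend on \<open>w\<close>, therefore outweigh the
  second ones in total, and the polynomial does not vanish at \<open>z\<close>.
\<close>

section \<open>Increasing enumerations and covered initial segments\<close>

lemma strict_mono_on_lessThan_iff:
  fixes f :: "nat \<Rightarrow> 'b :: order"
  shows "strict_mono_on {..<m} f \<longleftrightarrow> (\<forall>i. Suc i < m \<longrightarrow> f i < f (Suc i))"
proof
  show "strict_mono_on {..<m} f \<Longrightarrow> \<forall>i. Suc i < m \<longrightarrow> f i < f (Suc i)"
    by (auto simp: strict_mono_on_def)
next
  assume step: "\<forall>i. Suc i < m \<longrightarrow> f i < f (Suc i)"
  have "f i < f j" if "i < j" "j < m" for i j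
    using that
  proof (induction j)
    case (Suc j)
    have "f j < f (Suc j)" using step Suc.prems by blast
    then show ?case
      using Suc by (metis Suc_lessD less_Suc_eq order_less_trans)
  qed simp
  then show "strict_mono_on {..<m} f"
    by (auto intro!: strict_mono_onI)
qed

lemma strict_mono_on_lessThan_unique:
  fixes f g :: "nat \<Rightarrow> 'b :: linorder"
  assumes "strict_mono_on {..<m} f" "strict_mono_on {..<m} g"
    and "f ` {..<m} = g ` {..<m}" and "i < m"
  shows "f i = g i"
proof -
  have sorted: "sorted_wrt (<) (map h [0..<m])" if "strict_mono_on {..<m} h" for h :: "nat \<Rightarrow> 'b"
    using that by (auto simp: sorted_wrt_iff_nth_less strict_mono_on_def)
  have "map f [0..<m] = map g [0..<m]"
    by (rule strict_sorted_equal)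
       (use assms sorted in \<open>simp_all add: atLeast0LessThan\<close>)
  then show ?thesis
    using \<open>i < m\<close> by (simp add: map_eq_conv)
qed

lemma ex_increasing_enumeration:
  fixes U :: "nat set"
  assumes "finite U"
  obtains e where "bij_betw e {1..card U} U" "strict_mono_on {1..card U} e"
proof -
  obtain e where e: "bij_betw e {..<card U} U" "strict_mono_on {..<card U} e"
    using ex_bij_betw_strict_mono_card[OF assms] by blast
  have "bij_betw (\<lambda>i. i - 1) {1..card U} {..<card U}"
    by (rule bij_betwI[where g = Suc]) auto
  then have "bij_betw (e \<circ> (\<lambda>i. i - 1)) {1..card U} U"
    using e(1) by (rule bij_betw_trans)
  moreover have "strict_mono_on {1..card U} (e \<circ> (\<lambda>i. i - 1))"
  proof (rule strict_mono_onI)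
    fix x y assume "x \<in> {1..card U}" "y \<in> {1..card U}" "x < y"
    then show "(e \<circ> (\<lambda>i. i - 1)) x < (e \<circ> (\<lambda>i. i - 1)) y"
      using strict_mono_onD[OF e(2), of "x - 1" "y - 1"] by auto
  qed
  ultimately show ?thesis using that by blast
qed

text \<open>
  Let \<open>U\<close> be the set of labels of the forest, enumerated increasingly by \<open>e\<close>, and let \<open>J\<close> be the
  set of ranks within \<open>U\<close> of the labels of its roots. The chain receives the complement of
  \<open>U\<close>, so the left-hand side says that some chain label lies below all root labels. If \<open>j\<close> is
  the least rank, this fails exactly if every label below \<open>e j\<close> is in \<open>U\<close>, that is, if
  \<open>e j = j\<close> and \<open>{1..j} \<subseteq> U\<close>. For a forest without roots the minimum is
  \<open>Suc h\<close>, and a set of size \<open>h\<close> never contains \<open>{1..Suc h}\<close>; this convention lets the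
  empty forest share all the later formulas.
\<close>

lemma gap_below_iff_initial_segment_not_covered:
  fixes U :: "nat set"
  assumes U: "U \<subseteq> {1..n}"
    and e: "bij_betw e {1..h} U" "strict_mono_on {1..h} e"
    and J: "J \<subseteq> {1..h}"
    and "J = {} \<Longrightarrow> h < n"
  shows "(\<exists>x\<in>{1..n} - U. \<forall>y\<in>J. x < e y) \<longleftrightarrow> \<not> {1..Min (insert (Suc h) J)} \<subseteq> U"
proof (cases "J = {}")
  case True
  have fin: "finite U" and cU: "card U = h"
    using U e(1) by (auto simp: finite_subset dest: bij_betw_same_card)
  have "\<not> {1..n} \<subseteq> U" "\<not> {1..Suc h} \<subseteq> U"
    using card_mono[OF fin, of "{1..n}"] card_mono[OF fin, of "{1..Suc h}"] cU assms(5) True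
    by auto
  then show ?thesis using True by auto
next
  case False
  define j where "j = Min J"
  have fJ: "finite J" using J finite_subset by blast
  have j: "j \<in> J" "\<And>y. y \<in> J \<Longrightarrow> j \<le> y"
    using fJ False by (auto simp: j_def)
  have jh: "1 \<le> j" "j \<le> h" using j J by auto
  have Mj: "Min (insert (Suc h) J) = j"
    using fJ False jh by (simp add: j_def)
  have ej: "e j \<in> U" using e(1) jh by (auto simp: bij_betw_def)
  have e_less: "e x < e y" if "1 \<le> x" "x < y" "y \<le> h" for x y
    using e(2) that by (simp add: strict_mono_on_def)
  have le: "e j \<le> e y" if "y \<in> J" for y
    using e_less[of j y] j(2)[OF that] subsetD[OF J that] jh by (cases "j = y") auto
  have iff1: "(\<forall>y\<in>J. x < e y) \<longleftrightarrow> x < e j" for x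
    using le j(1) order_less_le_trans by blast
  have below: "U \<inter> {..<e j} = e ` {1..<j}"
  proof -
    have "e i < e j \<longleftrightarrow> i < j" if "i \<in> {1..h}" for i
      using e_less[of i j] e_less[of j i] that jh by (cases i j rule: linorder_cases) auto
    moreover have "U = e ` {1..h}" using e(1) by (simp add: bij_betw_def)
    ultimately show ?thesis using jh by auto
  qed
  \<comment> \<open>Counting the elements of \<open>U\<close> below \<open>e j\<close> is what relates the rank \<open>j\<close> to the value \<open>e j\<close>.\<close>
  have card_below: "card (U \<inter> {..<e j}) = j - 1"
    unfolding below using e(1) jh
    by (subst card_image) (auto simp: bij_betw_def intro: inj_on_subset)
  have fin: "finite (U \<inter> {..<e j})" by simp
  have ge: "j \<le> e j"
  proof -
    have "U \<inter> {..<e j} \<subseteq> {1..<e j}" using U by auto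
    then have "j - 1 \<le> e j - 1"
      using card_mono[of "{1..<e j}" "U \<inter> {..<e j}"] card_below by simp
    moreover have "1 \<le> e j" using ej U by auto
    ultimately show ?thesis by simp
  qed
  have "(\<exists>x\<in>{1..n} - U. x < e j) \<longleftrightarrow> \<not> {1..j} \<subseteq> U"
  proof
    assume "\<exists>x\<in>{1..n} - U. x < e j"
    then obtain x where x: "1 \<le> x" "x \<notin> U" "x < e j" by auto
    show "\<not> {1..j} \<subseteq> U"
    proof
      assume sub: "{1..j} \<subseteq> U"
      have "e j \<le> j"
      proof (rule ccontr)
        assume "\<not> e j \<le> j"
        then have "{1..j} \<subseteq> U \<inter> {..<e j}" using sub by auto
        from card_mono[OF fin this] show False using card_below jh by simp
      qed
      then show False using x subsetD[OF sub, of x] by auto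
    qed
  next
    assume "\<not> {1..j} \<subseteq> U"
    then obtain x where "x \<in> {1..j}" "x \<notin> U" by blast
    then have x: "1 \<le> x" "x \<le> j" "x \<notin> U" by simp_all
    moreover from this have "x < e j" using ge ej by (cases "x = e j") auto
    moreover have "e j \<le> n" using ej U by auto
    ultimately show "\<exists>x\<in>{1..n} - U. x < e j" by (intro bexI[of _ x]) auto
  qed
  then show ?thesis by (simp add: iff1 Mj)
qed

lemma card_subsets_containing_initial_segment:
  assumes "j \<le> h" "h \<le> n"
  shows "card {U. U \<subseteq> {1..n} \<and> card U = h \<and> {1..j} \<subseteq> U} = (n - j) choose (h - j)"
proof -
  have "bij_betw (\<lambda>W. {1..j} \<union> W) {W. W \<subseteq> {Suc j..n} \<and> card W = h - j}
          {U. U \<subseteq> {1..n} \<and> card U = h \<and> {1..j} \<subseteq> U}"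
  proof (rule bij_betwI[where g = "\<lambda>U. U - {1..j}"], goal_cases)
    case 1
    have "card ({1..j} \<union> W) = h" if "W \<subseteq> {Suc j..n}" "card W = h - j" for W
      using that assms finite_subset[OF that(1)] by (subst card_Un_disjoint) auto
    then show ?case using assms by auto
  next
    case 2
    have "card (U - {1..j}) = h - j" if "{1..j} \<subseteq> U" "card U = h" "U \<subseteq> {1..n}" for U
      using that finite_subset[OF that(3)] by (subst card_Diff_subset) auto
    then show ?case by force
  qed auto
  then have "card {U. U \<subseteq> {1..n} \<and> card U = h \<and> {1..j} \<subseteq> U} = card {W. W \<subseteq> {Suc j..n} \<and> card W = h - j}"
    using bij_betw_same_card by fastforce
  then show ?thesis using assms n_subsets[of "{Suc j..n}" "h - j"] by simp
qed

section \<open>Labelings of a forest hanging from a chain\<close>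

lemma finite_labelings: "finite V \<Longrightarrow> finite (labelings V)"
  by (rule finite_subset[of _ "V \<rightarrow>\<^sub>E {1..card V}"])
     (auto simp: labelings_def PiE_def bij_betw_def intro: finite_PiE[unfolded PiE_def])

text \<open>
  A labeling of a forest \<open>F\<close> together with a chain \<open>c\<close> is determined by the set \<open>U\<close> of labels of
  \<open>F\<close> and by the relative order of these labels: the chain has to receive the complement of
  \<open>U\<close> in increasing order. For fixed \<open>U\<close>, standardizing on \<open>F\<close> (\<open>std\<close>) and spreading a
  labeling of \<open>F\<close> over \<open>U\<close> (\<open>ext\<close>) are inverse bijections. Since \<open>Q\<close> depends on the relative
  order on \<open>F\<close> only, the one condition that mentions \<open>U\<close> is that the bottom of the chain is
  below the vertices in \<open>R\<close>. For an empty chain there is no such bottom vertex and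
  \<open>U = {1..card F}\<close>. Both sides are then zero if \<open>R\<close> is nonempty, but the right-hand side need not be
  zero if \<open>R\<close> is empty as well; hence the second assumption on \<open>R\<close>.
\<close>

lemma card_labelings_with_image:
  fixes c :: "nat \<Rightarrow> 'b" and Q :: "('b \<Rightarrow> nat) \<Rightarrow> bool"
  assumes F: "finite F" and c: "inj_on c {..<m}" "F \<inter> c ` {..<m} = {}"
    and R: "R \<subseteq> F" "R = {} \<Longrightarrow> 0 < m"
    and inv: "\<And>w w'. (\<And>x y. x \<in> F \<Longrightarrow> y \<in> F \<Longrightarrow> w x < w y \<longleftrightarrow> w' x < w' y) \<Longrightarrow> Q w \<longleftrightarrow> Q w'"
    and U: "U \<subseteq> {1..card F + m}" "card U = card F"
  shows "card {w \<in> labelings (F \<union> c ` {..<m}).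
            (Q w \<and> strict_mono_on {..<m} (w \<circ> c) \<and> 0 < m \<and> (\<forall>v\<in>R. w (c 0) < w v)) \<and> w ` F = U}
       = card {w \<in> labelings F. Q w \<and> \<not> {1..Min (insert (Suc (card F)) (w ` R))} \<subseteq> U}"
    (is "card ?D = card ?L")
proof -
  define h where "h = card F"
  define n where "n = h + m"
  define X where "X = F \<union> c ` {..<m}"
  define U' where "U' = {1..n} - U"
  have finU: "finite U" using U(1) finite_subset by blast
  have Un: "U \<subseteq> {1..n}" using U by (simp add: n_def h_def)
  have cX: "card X = n"
    using F c by (simp add: X_def n_def h_def card_Un_disjoint card_image)
  have cU': "card U' = m"
    unfolding U'_def using Un finU U(2) by (simp add: card_Diff_subset n_def h_def)
  obtain e where e: "bij_betw e {1..h} U" "strict_mono_on {1..h} e"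
    using ex_increasing_enumeration[OF finU] U(2) h_def by metis
  obtain f where f: "bij_betw f {..<m} U'" "strict_mono_on {..<m} f"
    using ex_bij_betw_strict_mono_card[of U'] cU' U'_def by auto
  have e_iff: "e x < e y \<longleftrightarrow> x < y" if "x \<in> {1..h}" "y \<in> {1..h}" for x y
    using e(2) that by (simp add: strict_mono_on_less)
  define ext where "ext w = (\<lambda>x. if x \<in> F then e (w x) else if x \<in> c ` {..<m}
      then f (the_inv_into {..<m} c x) else undefined)" for w :: "'b \<Rightarrow> nat"
  define std where "std w = restrict (the_inv_into {1..h} e \<circ> w) F" for w :: "'b \<Rightarrow> nat"
  have ext_F: "ext w x = e (w x)" if "x \<in> F" for w x
    using that by (simp add: ext_def)
  have ext_c: "ext w (c i) = f i" if "i < m" for w i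
    using that c by (auto simp: ext_def the_inv_into_f_f)
  have gap: "(0 < m \<and> (\<forall>v\<in>R. f 0 < e (w v))) \<longleftrightarrow> \<not> {1..Min (insert (Suc h) (w ` R))} \<subseteq> U"
    if w: "w \<in> labelings F" for w
  proof -
    have "(\<exists>x\<in>U'. \<forall>y\<in>w ` R. x < e y) \<longleftrightarrow> \<not> {1..Min (insert (Suc h) (w ` R))} \<subseteq> U"
      unfolding U'_def
      by (rule gap_below_iff_initial_segment_not_covered[OF Un e])
         (use w R in \<open>auto simp: labelings_def bij_betw_def h_def n_def\<close>)
    moreover have "(\<exists>x\<in>U'. \<forall>y\<in>w ` R. x < e y) \<longleftrightarrow> 0 < m \<and> (\<forall>v\<in>R. f 0 < e (w v))"
    proof -
      have U'_eq: "U' = f ` {..<m}" using f(1) by (simp add: bij_betw_def)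
      have "f 0 \<le> f i" if "i < m" for i
        using strict_mono_onD[OF f(2), of 0 i] that by (cases "i = 0") auto
      then show ?thesis unfolding U'_eq by (force intro: order_le_less_trans)
    qed
    ultimately show ?thesis by simp
  qed
  have Q_ext: "Q (ext w) \<longleftrightarrow> Q w" if "w \<in> labelings F" for w
    using that by (intro inv) (auto simp: ext_F labelings_def bij_betw_def h_def intro!: e_iff)
  have ext_lab: "ext w \<in> labelings X" "ext w ` F = U" if w: "w \<in> labelings F" for w
  proof -
    have wF: "bij_betw w F {1..h}" using w by (simp add: labelings_def h_def)
    have "bij_betw (ext w) F U"
      using bij_betw_trans[OF wF e(1)] by (rule bij_betw_cong[THEN iffD1, rotated]) (simp add: ext_F)
    then show "ext w ` F = U" by (simp add: bij_betw_def)
    have "bij_betw (the_inv_into {..<m} c) (c ` {..<m}) {..<m}"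
      using c(1) by (simp add: bij_betw_the_inv_into inj_on_imp_bij_betw)
    then have "bij_betw (f \<circ> the_inv_into {..<m} c) (c ` {..<m}) U'"
      using f(1) by (rule bij_betw_trans)
    then have "bij_betw (ext w) (c ` {..<m}) U'"
      by (rule bij_betw_cong[THEN iffD1, rotated])
         (use c in \<open>auto simp: ext_c the_inv_into_f_f\<close>)
    with \<open>bij_betw (ext w) F U\<close> have "bij_betw (ext w) X (U \<union> U')"
      unfolding X_def by (rule bij_betw_combine) (auto simp: U'_def)
    moreover have "U \<union> U' = {1..n}" using Un by (auto simp: U'_def)
    ultimately show "ext w \<in> labelings X"
      by (auto simp: labelings_def cX) (auto simp: ext_def X_def extensional_def)
  qed
  have std_lab: "std w \<in> labelings F" and ext_std: "\<And>x. x \<in> F \<Longrightarrow> e (std w x) = w x"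
    if "w \<in> labelings X" "w ` F = U" for w
  proof -
    have "inj_on w F" using that by (auto simp: labelings_def bij_betw_def X_def intro: inj_on_subset)
    then have "bij_betw w F U" using that by (simp add: bij_betw_def)
    then have "bij_betw (the_inv_into {1..h} e \<circ> w) F {1..h}"
      using bij_betw_the_inv_into[OF e(1)] by (rule bij_betw_trans)
    then show "std w \<in> labelings F" by (simp add: labelings_def std_def h_def)
    show "e (std w x) = w x" if "x \<in> F" for x
      using that \<open>bij_betw w F U\<close> e(1)
      by (auto simp: std_def bij_betw_def intro!: f_the_inv_into_f)
  qed
  have chain: "w (c i) = f i" if w: "w \<in> labelings X" "w ` F = U" "strict_mono_on {..<m} (w \<circ> c)" "i < m" for w i
  proof -
    have "inj_on w X" "w ` X = {1..n}" using w by (auto simp: labelings_def bij_betw_def cX)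
    then have "w ` c ` {..<m} = {1..n} - w ` F"
      using c(2) inj_on_image_set_diff[of w X X F]
      by (auto simp: X_def Int_commute dest: inj_onD)
    then have "(w \<circ> c) ` {..<m} = f ` {..<m}"
      using f(1) w(2) by (simp add: image_comp bij_betw_def U'_def)
    then show ?thesis
      using strict_mono_on_lessThan_unique[OF w(3) f(2) _ w(4)] by simp
  qed
  have "bij_betw ext ?L ?D"
  proof (rule bij_betwI[where g = std], goal_cases)
    case 1
    show ?case
    proof (intro Pi_I CollectI conjI)
      fix w assume w: "w \<in> ?L"
      then have wL: "w \<in> labelings F" by simp
      have g: "0 < m \<and> (\<forall>v\<in>R. f 0 < e (w v))"
        using gap[OF wL] w by (simp add: h_def)
      show "ext w \<in> labelings (F \<union> c ` {..<m})" "ext w ` F = U" using ext_lab[OF wL] by (simp_all add: X_def)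
      show "Q (ext w)" using w Q_ext by simp
      show "strict_mono_on {..<m} (ext w \<circ> c)" using f(2) by (simp add: strict_mono_on_def ext_c)
      show "0 < m" using g by simp
      show "\<forall>v\<in>R. ext w (c 0) < ext w v" using g R(1) by (auto simp: ext_c ext_F)
    qed
  next
    case 2
    show ?case
    proof (intro Pi_I CollectI conjI)
      fix w assume w: "w \<in> ?D"
      then have wX: "w \<in> labelings X" "w ` F = U" by (simp_all add: X_def)
      show lab: "std w \<in> labelings F" using std_lab[OF wX] .
      have "Q (ext (std w)) \<longleftrightarrow> Q w"
        by (rule inv) (simp add: ext_F ext_std[OF wX])
      then show "Q (std w)" using w Q_ext[OF lab] by simp
      have "0 < m" using w by simp
      then have "w (c 0) = f 0" using chain[OF wX] w by simp
      then have "0 < m \<and> (\<forall>v\<in>R. f 0 < e (std w v))"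
        using w R(1) ext_std[OF wX] by auto
      then show "\<not> {1..Min (insert (Suc (card F)) (std w ` R))} \<subseteq> U"
        using gap[OF lab] by (simp add: h_def)
    qed
  next
    case (3 w)
    then have wL: "w \<in> labelings F" by simp
    have "std (ext w) x = w x" for x
    proof (cases "x \<in> F")
      case True
      then have "w x \<in> {1..h}" using wL by (auto simp: labelings_def bij_betw_def h_def)
      then show ?thesis using True e(1) by (simp add: std_def ext_F bij_betw_def the_inv_into_f_f)
    next
      case False
      then show ?thesis using wL by (simp add: std_def labelings_def extensional_def)
    qed
    then show ?case by auto
  next
    case (4 w)
    then have wX: "w \<in> labelings X" "w ` F = U" "strict_mono_on {..<m} (w \<circ> c)" by (simp_all add: X_def)
    have "ext (std w) x = w x" for x
    proof -
      consider "x \<in> F" | i where "i < m" "x = c i" | "x \<notin> X" by (auto simp: X_def)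
      then show ?thesis
      proof cases
        case 3
        then show ?thesis using wX(1) by (auto simp: ext_def X_def labelings_def extensional_def)
      qed (use wX in \<open>simp_all add: ext_F ext_std ext_c chain\<close>)
    qed
    then show ?case by auto
  qed
  then show ?thesis by (simp add: bij_betw_same_card)
qed

text \<open>
  Double counting: the labelings of forest and chain are grouped by \<open>U\<close>, and the resulting
  pairs are regrouped by the standardized labeling of the forest.
\<close>

lemma card_labelings_over_chain:
  fixes c :: "nat \<Rightarrow> 'b" and Q :: "('b \<Rightarrow> nat) \<Rightarrow> bool"
  assumes F: "finite F" and c: "inj_on c {..<m}" "F \<inter> c ` {..<m} = {}"
    and R: "R \<subseteq> F" "R = {} \<Longrightarrow> 0 < m"
    and inv: "\<And>w w'. (\<And>x y. x \<in> F \<Longrightarrow> y \<in> F \<Longrightarrow> w x < w y \<longleftrightarrow> w' x < w' y) \<Longrightarrow> Q w \<longleftrightarrow> Q w'"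
  shows "card {w \<in> labelings (F \<union> c ` {..<m}).
            Q w \<and> strict_mono_on {..<m} (w \<circ> c) \<and> 0 < m \<and> (\<forall>v\<in>R. w (c 0) < w v)}
       = (\<Sum>w | w \<in> labelings F \<and> Q w. card {U. U \<subseteq> {1..card F + m} \<and> card U = card F \<and>
              \<not> {1..Min (insert (Suc (card F)) (w ` R))} \<subseteq> U})"
    (is "card ?D = _")
proof -
  define \<U> where "\<U> = {U. U \<subseteq> {1..card F + m} \<and> card U = card F}"
  let ?L = "{w \<in> labelings F. Q w}"
  let ?ok = "\<lambda>w U. \<not> {1..Min (insert (Suc (card F)) (w ` R))} \<subseteq> U"
  have fin: "finite \<U>" "finite ?L" "finite ?D"
    using F finite_labelings[of F] finite_labelings[of "F \<union> c ` {..<m}"]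
    by (auto simp: \<U>_def intro: finite_subset[of _ "Pow {1..card F + m}"])
  have cX: "card (F \<union> c ` {..<m}) = card F + m"
    using F c by (simp add: card_Un_disjoint card_image)
  have "(\<lambda>w. w ` F) ` ?D \<subseteq> \<U>"
  proof safe
    fix w assume "w \<in> labelings (F \<union> c ` {..<m})"
    then have "inj_on w (F \<union> c ` {..<m})" "w ` (F \<union> c ` {..<m}) = {1..card F + m}"
      by (simp_all add: labelings_def bij_betw_def cX)
    then show "w ` F \<in> \<U>"
      by (auto simp: \<U>_def inj_on_Un card_image)
  qed
  then have "card ?D = (\<Sum>U\<in>\<U>. card {w \<in> ?D. w ` F = U})"
    using sum.group[OF fin(3,1), of "\<lambda>w. w ` F" "\<lambda>_. 1 :: nat"] by simp
  also have "\<dots> = (\<Sum>U\<in>\<U>. card {w \<in> ?L. ?ok w U})"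
  proof (rule sum.cong[OF refl])
    fix U assume "U \<in> \<U>"
    then show "card {w \<in> ?D. w ` F = U} = card {w \<in> ?L. ?ok w U}"
      using card_labelings_with_image[OF F c R inv, where U = U] by (simp add: \<U>_def conj_assoc)
  qed
  also have "\<dots> = (\<Sum>w\<in>?L. card {U \<in> \<U>. ?ok w U})"
    using sum.swap_restrict[OF fin(1,2), of "\<lambda>_ _. 1 :: nat" "\<lambda>U w. ?ok w U"] by simp
  finally show ?thesis by (simp add: \<U>_def conj_assoc)
qed

section \<open>The counting polynomials and their roots\<close>

definition falling_poly :: "nat \<Rightarrow> nat \<Rightarrow> complex poly" where
  "falling_poly a b = (\<Prod>i\<in>{a..<b}. [:- of_nat i, 1:])"

lemma poly_falling_poly: "poly (falling_poly a b) z = (\<Prod>i\<in>{a..<b}. z - of_nat i)"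
  by (simp add: falling_poly_def poly_prod)

lemma falling_poly_degree: "degree (falling_poly a b) = b - a" "lead_coeff (falling_poly a b) = 1"
proof -
  show deg: "degree (falling_poly a b) = b - a"
    by (simp add: falling_poly_def degree_prod_sum_eq)
  show "lead_coeff (falling_poly a b) = 1"
    unfolding falling_poly_def lead_coeff_prod by simp
qed

text \<open>
  This is the polynomial \<open>binom(n, h) - binom(n - j, h - j)\<close> in \<open>n\<close>, counting the \<open>h\<close>-subsets of
  \<open>{1..n}\<close> that miss an element of \<open>{1..j}\<close>. Expressing \<open>h! / (h - j)!\<close> as the product of the
  \<open>h - i\<close> for \<open>i < j\<close> makes the second term vanish for \<open>j = Suc h\<close>, as it should.
\<close>

definition gap_poly :: "nat \<Rightarrow> nat \<Rightarrow> complex poly" where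
  "gap_poly h j = smult (1 / fact h)
     (falling_poly 0 h - smult (\<Prod>i<j. of_nat h - of_nat i) (falling_poly j h))"

lemma poly_gap_poly_eq_card:
  assumes "1 \<le> j" "j \<le> Suc h" "h \<le> n"
  shows "poly (gap_poly h j) (of_nat n) =
    of_nat (card {U. U \<subseteq> {1..n} \<and> card U = h \<and> \<not> {1..j} \<subseteq> U})"
proof -
  \<comment> \<open>The complementary count is simpler: \<open>?bad\<close> fixes \<open>j\<close> elements and chooses the others freely.\<close>
  let ?all = "{U. U \<subseteq> {1..n} \<and> card U = h}"
  let ?bad = "{U. U \<subseteq> {1..n} \<and> card U = h \<and> {1..j} \<subseteq> U}"
  have fin: "finite ?all" by (rule finite_subset[of _ "Pow {1..n}"]) auto
  have "{U. U \<subseteq> {1..n} \<and> card U = h \<and> \<not> {1..j} \<subseteq> U} = ?all - ?bad" by blast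
  moreover have sub: "?bad \<subseteq> ?all" by blast
  ultimately have "of_nat (card {U. U \<subseteq> {1..n} \<and> card U = h \<and> \<not> {1..j} \<subseteq> U}) =
      of_nat (card ?all) - (of_nat (card ?bad) :: complex)"
    using fin card_mono[OF fin sub] by (simp add: card_Diff_subset finite_subset of_nat_diff)
  moreover have "of_nat (card ?all) = (\<Prod>i\<in>{0..<h}. (of_nat n - of_nat i :: complex)) / fact h"
    using n_subsets[of "{1..n}" h] by (simp add: binomial_gbinomial gbinomial_prod_rev)
  moreover have "of_nat (card ?bad) =
      (\<Prod>i<j. of_nat h - of_nat i) * (\<Prod>i\<in>{j..<h}. (of_nat n - of_nat i :: complex)) / fact h"
  proof (cases "j \<le> h")
    case True
    have "fact h = (\<Prod>i<j. (of_nat h - of_nat i :: complex)) * fact (h - j)"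
    proof -
      have "(of_nat (h choose j) :: complex) = (\<Prod>i\<in>{0..<j}. of_nat h - of_nat i) / fact j"
        by (simp add: binomial_gbinomial gbinomial_prod_rev)
      then show ?thesis
        using binomial_fact[OF True, where 'a = complex]
        by (simp add: field_simps atLeast0LessThan)
    qed
    moreover have "(\<Prod>i\<in>{j..<h}. (of_nat n - of_nat i :: complex)) =
        (\<Prod>i\<in>{0..<h - j}. of_nat (n - j) - of_nat i)"
      by (rule prod.reindex_bij_witness[of _ "\<lambda>i. i + j" "\<lambda>i. i - j"])
         (use True assms in \<open>auto simp: of_nat_diff\<close>)
    moreover have "card ?bad = (n - j) choose (h - j)"
      by (rule card_subsets_containing_initial_segment) (use True assms in auto)
    moreover have "(\<Prod>i<j. (of_nat h - of_nat i :: complex)) \<noteq> 0"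
      using True by (auto simp: prod_zero_iff)
    ultimately show ?thesis by (simp add: binomial_gbinomial gbinomial_prod_rev)
  next
    case False
    then have j: "j = Suc h" using assms by simp
    have "card U \<noteq> h" if "{1..Suc h} \<subseteq> U" "U \<subseteq> {1..n}" for U
      using card_mono[OF finite_subset[OF that(2)] that(1)] by simp
    then have "?bad = {}" unfolding j by blast
    then have "card ?bad = 0" by (metis card.empty)
    moreover have "(\<Prod>i<j. (of_nat h - of_nat i :: complex)) = 0" by (simp add: j)
    ultimately show ?thesis by (simp only: of_nat_0 mult_zero_left div_0)
  qed
  ultimately show ?thesis
    by (simp add: gap_poly_def poly_falling_poly diff_divide_distrib)
qed

text \<open>
  Outside the disk of radius \<open>h\<close> every factor satisfies \<open>|z - i| > h - i\<close>. After cancelling the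
  common factors \<open>z - i\<close> with \<open>i \<ge> j\<close>, the claim compares the products over \<open>i < j\<close>
  factor by factor; \<open>j \<ge> 1\<close> makes the inequality strict. For \<open>j = Suc h\<close> the left-hand side is
  zero and the right-hand side is not.
\<close>

lemma norm_falling_tail_less:
  fixes z :: complex
  assumes "1 \<le> j" "j \<le> Suc h" "real h < cmod z"
  shows "cmod ((\<Prod>i<j. of_nat h - of_nat i) * poly (falling_poly j h) z)
    < cmod (poly (falling_poly 0 h) z)"
proof -
  have gt: "real h - real i < cmod (z - of_nat i)" for i
    using assms(3) norm_triangle_ineq2[of z "of_nat i"] by simp
  have nz: "poly (falling_poly a h) z \<noteq> 0" for a
  proof -
    have "z \<noteq> of_nat i" if "i < h" for i
      using gt[of i] that by auto
    then show ?thesis by (auto simp: poly_falling_poly prod_zero_iff)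
  qed
  show ?thesis
  proof (cases "j \<le> h")
    case True
    have "cmod (\<Prod>i<j. of_nat h - of_nat i) = (\<Prod>i<j. real h - real i)"
      unfolding prod_norm[symmetric]
    proof (rule prod.cong[OF refl])
      fix i assume "i \<in> {..<j}"
      then have "(of_nat h - of_nat i :: complex) = of_nat (h - i)" "real h - real i = real (h - i)"
        using True by (simp_all add: of_nat_diff)
      then show "cmod (of_nat h - of_nat i) = real h - real i" by (simp only: norm_of_nat)
    qed
    also have "\<dots> < (\<Prod>i<j. cmod (z - of_nat i))"
    proof (rule prod_mono_strict[of 0])
      fix i assume "i \<in> {..<j}"
      then show "0 \<le> real h - real i \<and> real h - real i \<le> cmod (z - of_nat i)"
        "0 < cmod (z - of_nat i)"
        using True gt[of i] by auto
    qed (use gt[of 0] assms(1) in auto)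
    finally have "cmod (\<Prod>i<j. of_nat h - of_nat i) * cmod (poly (falling_poly j h) z)
        < (\<Prod>i<j. cmod (z - of_nat i)) * cmod (poly (falling_poly j h) z)"
      using nz[of j] by simp
    also have "\<dots> = cmod (poly (falling_poly 0 h) z)"
      using prod.atLeastLessThan_concat[of 0 j h "\<lambda>i. z - of_nat i"] True
      by (simp add: poly_falling_poly prod_norm atLeast0LessThan flip: norm_mult)
    finally show ?thesis by (simp add: norm_mult)
  next
    case False
    then have "(\<Prod>i<j. (of_nat h - of_nat i :: complex)) = 0"
      using assms by (auto simp: prod_zero_iff intro!: bexI[of _ h])
    then show ?thesis using nz[of 0] by (simp only: mult_zero_left norm_zero zero_less_norm_iff) simp
  qed
qed

text \<open>
  Up to the factor \<open>1 / h!\<close>, the sum is \<open>card L\<close> copies of \<open>z (z - 1) \<dots> (z - h + 1)\<close> minus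
  \<open>card L\<close> terms, each of which is strictly smaller in modulus if \<open>|z| > h\<close>. So there is no
  cancellation to zero.
\<close>

lemma sum_gap_poly_root_bound:
  assumes "finite L" "L \<noteq> {}" and j: "\<And>w. w \<in> L \<Longrightarrow> 1 \<le> j w \<and> j w \<le> Suc h"
    and root: "poly (\<Sum>w\<in>L. gap_poly h (j w)) z = 0"
  shows "cmod z \<le> real h"
proof (rule ccontr)
  assume "\<not> cmod z \<le> real h"
  then have z: "real h < cmod z" by simp
  define P where "P = poly (falling_poly 0 h) z"
  define t where "t w = (\<Prod>i<j w. of_nat h - of_nat i) * poly (falling_poly (j w) h) z" for w
  have "(\<Sum>w\<in>L. P - t w) / fact h = 0"
    using root by (simp add: poly_sum gap_poly_def P_def t_def sum_divide_distrib)
  then have "of_nat (card L) * P = (\<Sum>w\<in>L. t w)"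
    by (simp add: sum_subtractf)
  then have "real (card L) * cmod P = cmod (\<Sum>w\<in>L. t w)"
    by (metis norm_mult norm_of_nat)
  also have "\<dots> \<le> (\<Sum>w\<in>L. cmod (t w))" by (rule norm_sum)
  also have "\<dots> < (\<Sum>w\<in>L. cmod P)"
    using norm_falling_tail_less[OF _ _ z] j assms(1,2)
    by (intro sum_strict_mono) (auto simp: P_def t_def)
  finally show False by simp
qed

text \<open>
  The subtracted term of \<open>gap_poly h j\<close> has degree \<open>h - j < h\<close> or is zero, so every summand
  contributes \<open>1 / h!\<close> to the coefficient of degree \<open>h\<close>.
\<close>

lemma degree_sum_gap_poly:
  assumes "finite L" "L \<noteq> {}" and j: "\<And>w. w \<in> L \<Longrightarrow> 1 \<le> j w \<and> j w \<le> Suc h"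
  shows "h \<le> degree (\<Sum>w\<in>L. gap_poly h (j w))"
proof (rule le_degree)
  have "coeff (gap_poly h (j w)) h = 1 / fact h" if "w \<in> L" for w
  proof -
    have "coeff (falling_poly 0 h) h = 1" using falling_poly_degree[of 0 h] by simp
    moreover have "(\<Prod>i<j w. (of_nat h - of_nat i :: complex)) * coeff (falling_poly (j w) h) h = 0"
    proof (cases "j w \<le> h")
      case True
      then have "degree (falling_poly (j w) h) < h"
        using j[OF that] by (simp add: falling_poly_degree)
      then show ?thesis by (simp add: coeff_eq_0)
    next
      case False
      then show ?thesis using j[OF that] by (auto simp: prod_zero_iff intro!: bexI[of _ h])
    qed
    ultimately show ?thesis by (simp add: gap_poly_def)
  qed
  then have "coeff (\<Sum>w\<in>L. gap_poly h (j w)) h = of_nat (card L) / fact h"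
    by (simp add: coeff_sum)
  then show "coeff (\<Sum>w\<in>L. gap_poly h (j w)) h \<noteq> 0"
    using assms(1,2) by (simp add: card_gt_0_iff)
qed

text \<open>
  Two polynomials that agree at all large integers are equal, so \<open>tree_d_poly\<close> is any polynomial
  that interpolates the counts.
\<close>

lemma tree_d_poly_eqI:
  assumes "\<And>n. card V \<le> n \<Longrightarrow> poly q (of_nat n) = of_nat (tree_d V r p VD n)"
  shows "tree_d_poly V r p VD = q"
  unfolding tree_d_poly_def
proof (rule the_equality)
  fix q' :: "complex poly" assume q': "\<forall>n\<ge>card V. poly q' (of_nat n) = of_nat (tree_d V r p VD n)"
  have "(of_nat ` {card V..} :: complex set) \<subseteq> {x. poly (q' - q) x = 0}"
    using assms q' by auto
  moreover have "infinite (of_nat ` {card V..} :: complex set)"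
    by (simp add: finite_image_iff infinite_Ici inj_on_def)
  ultimately have "infinite {x. poly (q' - q) x = 0}"
    using finite_subset by blast
  then show "q' = q"
    using poly_roots_finite[of "q' - q"] by auto
qed (use assms in blast)

section \<open>Descent labelings of trees\<close>

lemma ex_labeling_of_ranking:
  fixes f :: "'b \<Rightarrow> int"
  assumes "finite F" "inj_on f F"
  obtains w where "w \<in> labelings F" "\<And>x y. x \<in> F \<Longrightarrow> y \<in> F \<Longrightarrow> w x < w y \<longleftrightarrow> f x < f y"
proof -
  \<comment> \<open>Standardization of \<open>f\<close>: each value is replaced by its position in the sorted image.\<close>
  define rank where "rank x = card {y \<in> F. f y \<le> f x}" for x
  have mono: "rank x < rank y" if "x \<in> F" "y \<in> F" "f x < f y" for x y
  proof -
    have "y \<in> {z \<in> F. f z \<le> f y}" "y \<notin> {z \<in> F. f z \<le> f x}" using that by auto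
    moreover have "{z \<in> F. f z \<le> f x} \<subseteq> {z \<in> F. f z \<le> f y}" using that by auto
    ultimately have "{z \<in> F. f z \<le> f x} \<subset> {z \<in> F. f z \<le> f y}" by blast
    then show ?thesis unfolding rank_def using assms(1) by (simp add: psubset_card_mono)
  qed
  have iff: "rank x < rank y \<longleftrightarrow> f x < f y" if "x \<in> F" "y \<in> F" for x y
    using mono[of x y] mono[of y x] that assms(2)
    by (cases "f x" "f y" rule: linorder_cases) (auto dest: inj_onD)
  have inj: "inj_on rank F"
  proof (rule inj_onI)
    fix x y assume xy: "x \<in> F" "y \<in> F" "rank x = rank y"
    then have "f x = f y" using mono[of x y] mono[of y x]
      by (cases "f x" "f y" rule: linorder_cases) auto
    then show "x = y" using xy assms(2) by (auto dest: inj_onD)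
  qed
  have sub: "rank ` F \<subseteq> {1..card F}"
  proof (clarsimp simp: rank_def)
    fix x assume x: "x \<in> F"
    have "0 < card {y \<in> F. f y \<le> f x}" using x assms(1) by (auto simp: card_gt_0_iff)
    moreover have "card {y \<in> F. f y \<le> f x} \<le> card F" using assms(1) by (intro card_mono) auto
    ultimately show "Suc 0 \<le> card {y \<in> F. f y \<le> f x} \<and> card {y \<in> F. f y \<le> f x} \<le> card F" by simp
  qed
  have "rank ` F = {1..card F}"
    using card_subset_eq[OF _ sub] card_image[OF inj] by simp
  then have "restrict rank F \<in> labelings F"
    using inj by (simp add: labelings_def bij_betw_def)
  then show ?thesis using iff that by simp
qed

context rooted_tree
begin

text \<open>
  Let \<open>key\<close> be injective, positive and larger at a vertex than at its parent: breadth-first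
  order has this property. Giving \<open>key\<close> the sign plus at the descent vertices and minus elsewhere
  makes the sign of a vertex alone decide how it compares with its parent.
\<close>

lemma ex_ranking_with_descents:
  obtains f :: "'a \<Rightarrow> int" where "inj_on f V"
    "\<And>v. v \<in> V \<Longrightarrow> v \<noteq> r \<Longrightarrow> f (p v) < f v \<longleftrightarrow> v \<in> VD"
proof -
  define depth where "depth v = (LEAST k. (p ^^ k) v = r)" for v
  have depth: "depth v = Suc (depth (p v))" if "v \<in> V" "v \<noteq> r" for v
  proof -
    have "\<exists>k. (p ^^ k) v = r" using reach that by blast
    then obtain k where "(p ^^ k) v = r" ..
    then have "depth v = Suc (LEAST k. (p ^^ Suc k) v = r)"
      unfolding depth_def by (rule Least_Suc) (use that in simp)
    then show ?thesis by (simp add: depth_def funpow_swap1)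
  qed
  obtain idx where idx: "bij_betw idx V {0..<card V}"
    using ex_bij_betw_finite_nat[OF finite_verts] by blast
  define key where "key v = depth v * card V + idx v + 1" for v
  have idx_less: "idx v < card V" if "v \<in> V" for v
    using idx that by (auto simp: bij_betw_def)
  have key_inj: "inj_on key V"
  proof (rule inj_onI)
    fix u v assume uv: "u \<in> V" "v \<in> V" "key u = key v"
    then have "(depth u * card V + idx u) mod card V = (depth v * card V + idx v) mod card V"
      by (simp add: key_def)
    then have "idx u = idx v" using idx_less uv by simp
    then show "u = v" using idx uv by (auto simp: bij_betw_def dest: inj_onD)
  qed
  have key_less: "key (p v) < key v" if "v \<in> V" "v \<noteq> r" for v
    using depth[OF that] idx_less[OF parent_in[OF that]] by (simp add: key_def)
  define f where "f v = (if v \<in> VD then int (key v) else - int (key v))" for v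
  have "inj_on f V"
  proof (rule inj_onI)
    fix u v assume uv: "u \<in> V" "v \<in> V" "f u = f v"
    moreover have "0 < key u" "0 < key v" by (simp_all add: key_def)
    ultimately have "key u = key v" by (auto simp: f_def split: if_splits)
    then show "u = v" using key_inj uv by (blast dest: inj_onD)
  qed
  moreover have "f (p v) < f v \<longleftrightarrow> v \<in> VD" if "v \<in> V" "v \<noteq> r" for v
    using key_less[OF that] by (auto simp: f_def)
  ultimately show ?thesis using that by blast
qed

text \<open>
  Vertices whose parent is outside \<open>F\<close> are the roots of the forest induced on \<open>F\<close> and are
  unconstrained. The labels sit on the copy of \<open>F\<close> inside \<open>G(T;n)\<close>, so that these functions can
  be compared with labelings of \<open>G(T;n)\<close> directly.
\<close>

definition forest_labelings :: "'a set \<Rightarrow> 'a set \<Rightarrow> ('a + nat \<Rightarrow> nat) set" where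
  "forest_labelings VD F = {w \<in> labelings (Inl ` F).
     \<forall>v\<in>F - {r}. p v \<in> F \<longrightarrow> (w (Inl (p v)) < w (Inl v) \<longleftrightarrow> v \<in> VD)}"

lemma finite_forest_labelings: "F \<subseteq> V \<Longrightarrow> finite (forest_labelings VD F)"
  unfolding forest_labelings_def
  by (rule finite_subset[OF _ finite_labelings[of "Inl ` F"]])
     (auto intro: finite_subset[OF _ finite_verts])

text \<open>
  Standardizing the ranking of \<open>ex_ranking_with_descents\<close> on \<open>F\<close> gives a witness. This is what
  excludes the zero polynomial, which vanishes everywhere.
\<close>

lemma forest_labelings_nonempty:
  assumes "F \<subseteq> V"
  shows "forest_labelings VD F \<noteq> {}"
proof -
  obtain f :: "'a \<Rightarrow> int" where f: "inj_on f V"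
    "\<And>v. v \<in> V \<Longrightarrow> v \<noteq> r \<Longrightarrow> f (p v) < f v \<longleftrightarrow> v \<in> VD"
    using ex_ranking_with_descents[of VD] by blast
  have "finite (Inl ` F :: ('a + nat) set)" "inj_on (f \<circ> projl) (Inl ` F :: ('a + nat) set)"
    using assms finite_verts f(1) by (auto simp: inj_on_def dest: finite_subset)
  then obtain w where "w \<in> labelings (Inl ` F :: ('a + nat) set)"
    "\<And>x y. x \<in> Inl ` F \<Longrightarrow> y \<in> Inl ` F \<Longrightarrow> w x < w y \<longleftrightarrow> (f \<circ> projl) x < (f \<circ> projl) y"
    using ex_labeling_of_ranking[of "Inl ` F :: ('a + nat) set" "f \<circ> projl"] by metis
  then have "w \<in> forest_labelings VD F"
    using f(2) assms by (auto simp: forest_labelings_def)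
  then show ?thesis by blast
qed

text \<open>
  The three kinds of edges of \<open>G(T;n)\<close>: those inside \<open>T\<close>, the edge from the root of \<open>T\<close> to the
  chain, and those inside the chain. If the chain is empty, the root of \<open>T\<close> is the root of
  \<open>G(T;n)\<close> and cannot be a descent, whence the condition \<open>r \<notin> VD\<close>.
\<close>

lemma mem_tree_D_iff:
  assumes "VD \<subseteq> V" and w: "w \<in> labelings (G_verts V n)"
  shows "w \<in> tree_D V r p VD n \<longleftrightarrow>
     (\<forall>v\<in>V - {r}. w (Inl (p v)) < w (Inl v) \<longleftrightarrow> v \<in> VD)
     \<and> (if card V < n then w (Inr 0) < w (Inl r) \<longleftrightarrow> r \<in> VD else r \<notin> VD)
     \<and> strict_mono_on {..<n - card V} (w \<circ> Inr)"
    (is "?L \<longleftrightarrow> ?T \<and> ?R \<and> ?C")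
proof -
  let ?DesP = "\<lambda>x. x \<in> G_verts V n - {G_root V r n} \<and> w (G_parent r p x) < w x"
  have "?L \<longleftrightarrow> (\<forall>x. ?DesP x \<longleftrightarrow> x \<in> Inl ` VD)"
    using w by (auto simp: tree_D_def Des_def)
  also have "\<dots> \<longleftrightarrow> (\<forall>v. ?DesP (Inl v) \<longleftrightarrow> v \<in> VD) \<and> (\<forall>i. \<not> ?DesP (Inr i))"
    by (auto simp: split_sum_all)
  also have "(\<forall>v. ?DesP (Inl v) \<longleftrightarrow> v \<in> VD) \<longleftrightarrow> ?T \<and> ?R"
    using assms(1) root_in by (auto simp: G_verts_def G_root_def G_parent_def)
  also have "(\<forall>i. \<not> ?DesP (Inr i)) \<longleftrightarrow> ?C"
  proof -
    have "w (Inr i) \<noteq> w (Inr (Suc i))" if "Suc i < n - card V" for i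
      using w that by (auto simp: labelings_def bij_betw_def G_verts_def dest: inj_onD)
    moreover have "?DesP (Inr i) \<longleftrightarrow> Suc i < n - card V \<and> w (Inr (Suc i)) < w (Inr i)" for i
      by (auto simp: G_verts_def G_root_def G_parent_def)
    ultimately show ?thesis
      unfolding strict_mono_on_lessThan_iff by (metis comp_apply not_less_iff_gr_or_eq)
  qed
  finally show ?thesis by simp
qed

text \<open>
  If the root of \<open>T\<close> is a descent vertex, the forest is all of \<open>T\<close>, hanging by its root from the
  chain of added vertices.
\<close>

lemma tree_d_root_descent:
  assumes VD: "VD \<subseteq> V" "r \<in> VD" and n: "card V \<le> n"
  shows "tree_d V r p VD n = (\<Sum>w\<in>forest_labelings VD V. card {U. U \<subseteq> {1..n} \<and> card U = card V \<and>
              \<not> {1..Min (insert (Suc (card V)) (w ` Inl ` {r}))} \<subseteq> U})"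
proof -
  let ?F = "Inl ` V :: ('a + nat) set" and ?m = "n - card V"
  let ?Q = "\<lambda>w :: 'a + nat \<Rightarrow> nat. \<forall>v\<in>V - {r}. p v \<in> V \<longrightarrow> (w (Inl (p v)) < w (Inl v) \<longleftrightarrow> v \<in> VD)"
  have cF: "card ?F = card V" by (simp add: card_image)
  have G: "G_verts V n = ?F \<union> Inr ` {..<?m}" by (simp add: G_verts_def)
  have D_eq: "tree_D V r p VD n = {w \<in> labelings (?F \<union> Inr ` {..<?m}).
      ?Q w \<and> strict_mono_on {..<?m} (w \<circ> Inr) \<and> 0 < ?m \<and> (\<forall>v\<in>Inl ` {r}. w (Inr 0) < w v)}"
    (is "_ = ?D")
  proof (rule set_eqI)
    fix w
    show "w \<in> tree_D V r p VD n \<longleftrightarrow> w \<in> ?D"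
    proof (cases "w \<in> labelings (G_verts V n)")
      case True
      show ?thesis
        using True VD parent_in unfolding mem_tree_D_iff[OF VD(1) True] G by auto
    next
      case False
      then show ?thesis by (simp add: tree_D_def G)
    qed
  qed
  have "card (tree_D V r p VD n) = (\<Sum>w | w \<in> labelings ?F \<and> ?Q w. card {U. U \<subseteq> {1..card ?F + ?m} \<and>
      card U = card ?F \<and> \<not> {1..Min (insert (Suc (card ?F)) (w ` Inl ` {r}))} \<subseteq> U})"
    unfolding D_eq by (rule card_labelings_over_chain) (use finite_verts root_in in \<open>auto simp: inj_on_def\<close>)
  then show ?thesis using n by (simp add: tree_d_def forest_labelings_def cF)
qed

text \<open>
  If the root \<open>r\<close> of \<open>T\<close> is an ascent vertex, it continues the chain of added vertices downwards;
  \<open>?c\<close> is this extended chain. What hangs from it is the forest of the proper subtrees of \<open>T\<close>,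
  and all of its roots, the children of \<open>r\<close>, are descents.
\<close>

lemma tree_d_root_children_descents:
  assumes VD: "VD \<subseteq> V" "r \<notin> VD" "children V r p r \<subseteq> VD" and n: "card V \<le> n"
  shows "tree_d V r p VD n = (\<Sum>w\<in>forest_labelings VD (V - {r}). card {U. U \<subseteq> {1..n} \<and>
     card U = card (V - {r}) \<and>
     \<not> {1..Min (insert (Suc (card (V - {r}))) (w ` Inl ` children V r p r))} \<subseteq> U})"
proof -
  let ?F = "Inl ` (V - {r}) :: ('a + nat) set" and ?m = "Suc (n - card V)"
  let ?R = "Inl ` children V r p r :: ('a + nat) set"
  let ?c = "case_nat (Inl r) Inr :: nat \<Rightarrow> 'a + nat"
  let ?Q = "\<lambda>w :: 'a + nat \<Rightarrow> nat. \<forall>v\<in>V - {r} - {r}.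
     p v \<in> V - {r} \<longrightarrow> (w (Inl (p v)) < w (Inl v) \<longleftrightarrow> v \<in> VD)"
  have cF: "card ?F = card (V - {r})" by (simp add: card_image)
  have "card V > 0" using finite_verts root_in by (auto simp: card_gt_0_iff)
  then have cFm: "card (V - {r}) + ?m = n"
    using n root_in finite_verts by (simp add: card_Diff_singleton)
  have c_im: "?c ` {..<?m} = insert (Inl r) (Inr ` {..<n - card V})"
    by (simp add: lessThan_Suc_eq_insert_0 image_image)
  have G: "G_verts V n = ?F \<union> ?c ` {..<?m}"
    unfolding c_im G_verts_def using root_in by auto
  have chain_iff: "strict_mono_on {..<?m} (w \<circ> ?c) \<longleftrightarrow>
      (card V < n \<longrightarrow> w (Inl r) < w (Inr 0)) \<and> strict_mono_on {..<n - card V} (w \<circ> Inr)"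
    for w :: "'a + nat \<Rightarrow> nat"
  proof -
    have split: "(\<forall>i. P i) \<longleftrightarrow> P 0 \<and> (\<forall>i. P (Suc i))" for P :: "nat \<Rightarrow> bool"
      by (metis not0_implies_Suc)
    show ?thesis
      unfolding strict_mono_on_lessThan_iff by (subst split) auto
  qed
  have D_eq: "tree_D V r p VD n = {w \<in> labelings (?F \<union> ?c ` {..<?m}).
      ?Q w \<and> strict_mono_on {..<?m} (w \<circ> ?c) \<and> 0 < ?m \<and> (\<forall>v\<in>?R. w (?c 0) < w v)}"
    (is "_ = ?D")
  proof (rule set_eqI)
    fix w
    show "w \<in> tree_D V r p VD n \<longleftrightarrow> w \<in> ?D"
    proof (cases "w \<in> labelings (G_verts V n)")
      case True
      have neq: "card V < n \<Longrightarrow> w (Inr 0) \<noteq> w (Inl r)"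
        using True root_in by (auto simp: labelings_def bij_betw_def G_verts_def dest: inj_onD)
      have "(\<forall>v\<in>V - {r}. w (Inl (p v)) < w (Inl v) \<longleftrightarrow> v \<in> VD) \<longleftrightarrow>
          ?Q w \<and> (\<forall>v\<in>?R. w (Inl r) < w v)"
        using VD(3) parent_in by (auto simp: children_def)
      moreover have "(if card V < n then w (Inr 0) < w (Inl r) \<longleftrightarrow> r \<in> VD else r \<notin> VD) \<longleftrightarrow>
          (card V < n \<longrightarrow> w (Inl r) < w (Inr 0))"
        using VD(2) neq by auto
      ultimately show ?thesis
        using True unfolding mem_tree_D_iff[OF VD(1) True] mem_Collect_eq chain_iff G by auto
    next
      case False
      then show ?thesis by (simp add: tree_D_def G)
    qed
  qed
  have "card (tree_D V r p VD n) = (\<Sum>w | w \<in> labelings ?F \<and> ?Q w. card {U. U \<subseteq> {1..card ?F + ?m} \<and>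
      card U = card ?F \<and> \<not> {1..Min (insert (Suc (card ?F)) (w ` ?R))} \<subseteq> U})"
    unfolding D_eq by (rule card_labelings_over_chain)
       (use finite_verts in \<open>auto simp: inj_on_def children_def split: nat.splits\<close>)
  then show ?thesis unfolding tree_d_def forest_labelings_def cF cFm .
qed

text \<open>
  The two ways of splitting \<open>G(T;n)\<close> into a forest and a chain lead to the same formula for
  different \<open>F\<close> and \<open>R\<close>, and the bound follows from the formula alone.
\<close>

lemma root_bound_of_shuffle_formula:
  assumes F: "F \<subseteq> V" "R \<subseteq> F"
    and count: "\<And>n. card V \<le> n \<Longrightarrow> tree_d V r p VD n = (\<Sum>w\<in>forest_labelings VD F.
      card {U. U \<subseteq> {1..n} \<and> card U = card F \<and> \<not> {1..Min (insert (Suc (card F)) (w ` Inl ` R))} \<subseteq> U})"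
    and root: "poly (tree_d_poly V r p VD) z = 0"
  shows "cmod z \<le> real (degree (tree_d_poly V r p VD))"
proof -
  let ?h = "card F"
  define j where "j w = Min (insert (Suc ?h) (w ` Inl ` R))" for w :: "'a + nat \<Rightarrow> nat"
  have j: "1 \<le> j w \<and> j w \<le> Suc ?h" if "w \<in> forest_labelings VD F" for w
  proof -
    have "w ` Inl ` R \<subseteq> {1..?h}"
      using that F(2) by (auto simp: forest_labelings_def labelings_def bij_betw_def card_image)
    also have "\<dots> \<subseteq> {1..Suc ?h}" by simp
    finally have sub: "insert (Suc ?h) (w ` Inl ` R) \<subseteq> {1..Suc ?h}" by simp
    moreover have "j w \<in> insert (Suc ?h) (w ` Inl ` R)"
      unfolding j_def using finite_subset[OF sub] by (intro Min_in) simp_all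
    ultimately have "j w \<in> {1..Suc ?h}" by blast
    then show ?thesis by simp
  qed
  have q: "tree_d_poly V r p VD = (\<Sum>w\<in>forest_labelings VD F. gap_poly ?h (j w))"
  proof (rule tree_d_poly_eqI)
    fix n assume n: "card V \<le> n"
    then have "?h \<le> n" using card_mono[OF finite_verts F(1)] by simp
    then show "poly (\<Sum>w\<in>forest_labelings VD F. gap_poly ?h (j w)) (of_nat n) = of_nat (tree_d V r p VD n)"
      using j by (simp add: poly_sum poly_gap_poly_eq_card count[OF n] j_def)
  qed
  note L = finite_forest_labelings[OF F(1)] forest_labelings_nonempty[OF F(1)]
  have "cmod z \<le> real ?h"
    by (intro sum_gap_poly_root_bound[OF L _ root[unfolded q]] j)
  also have "?h \<le> degree (tree_d_poly V r p VD)"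
    unfolding q by (intro degree_sum_gap_poly[OF L] j)
  finally show ?thesis by simp
qed

end

theorem proposition4p1:
  fixes V :: "'a set" and r :: 'a and p :: "'a \<Rightarrow> 'a" and VD :: "'a set" and z :: complex
  assumes "rooted_tree V r p"
    and "VD \<subseteq> V"
    and "r \<in> VD \<or> children V r p r \<subseteq> VD"
    and "poly (tree_d_poly V r p VD) z = 0"
  shows "cmod z \<le> real (degree (tree_d_poly V r p VD))"
proof -
  interpret rooted_tree V r p by fact
  show ?thesis
  proof (cases "r \<in> VD")
    case True
    show ?thesis
      by (rule root_bound_of_shuffle_formula[OF _ _ tree_d_root_descent[OF assms(2) True] assms(4)])
         (use root_in in auto)
  next
    case False
    with assms(3) have "children V r p r \<subseteq> VD" by blast
    then show ?thesis
      by (intro root_bound_of_shuffle_formula[OF _ _ tree_d_root_children_descents[OF assms(2) False] assms(4)])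
         (auto simp: children_def)
  qed
qed

end
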